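(* Let $n\ge 1$. There exists a bijection $\Lambda:\mathrm{Web}_n\to\Delta_n$ such that $\mathrm{drop}(\sigma)=\widehat{\mathrm{drop}}(\Lambda(\sigma))$ for every $\sigma\in\mathrm{Web}_n$. Consequently, for $0\le i\le\lfloor n/2\rfloor$, $$d_{n+1,i}(\alpha,t)=\sum_{\substack{\sigma\in\Delta_n\\ \widehat{\mathrm{drop}}(\sigma)=i}}t^{\mathrm{fix}(\sigma)}\alpha^{\mathrm{cyc}(\sigma)}.$$
   Context: $\mathfrak{S}_n$ is the set of permutations of $[n]=\{1,\dots,n\}$. For $\sigma\in\mathfrak{S}_n$: $\mathrm{drop}(\sigma)$ is the number of indices $i$ with $i>\sigma_i$, $\mathrm{fix}(\sigma)$ is the number of fixed points, and $\mathrm{cyc}(\sigma)$ is the number of cycles (fixed points included). André permutations: the empty word is an André permutation. A word $w=w_1\cdots w_n$ ($n\ge1$) of distinct positive integers with smallest letter $w_k$ is an André permutation if $w_1\cdots w_{k-1}$ and $w_{k+1}\cdots w_n$ are both André permutations and $\max\{w_1,\dots,w_n\}=\max\{w_k,\dots,w_n\}$. A cycle $C=(a_1,\dots,a_k)$, written with $a_1=\min\{a_1,\dots,a_k\}$, is an André cycle if the word $a_2\cdots a_k$ is an André permutation. $\mathrm{Web}_n$ is the set of web permutations in $\mathfrak{S}_n$; by a known theorem of Hwang, Jang and Oh these are exactly the permutations all of whose cycles are André cycles, and this may be taken as the definition here. A cycle $C=(a_1,\dots,a_k)$ with $a_1=\min\{a_1,\dots,a_k\}$ is up-down if $a_1<a_2>a_3<\cdots$.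 $\Delta_n$ is the set of cycle-up-down permutations in $\mathfrak{S}_n$, i.e. those all of whose cycles are up-down. Statistic $\mathrm{mix}$ on words of distinct integers: $\mathrm{mix}(\emptyset)=0$. For $\sigma=\sigma_1\cdots\sigma_n$, $n\ge1$, let $j$ be the least index such that $\sigma_j=\min\{\sigma_1,\dots,\sigma_n\}$ or $\sigma_j=\max\{\sigma_1,\dots,\sigma_n\}$; then $\mathrm{mix}(\sigma)=0$ if $n=1$, and otherwise $\mathrm{mix}(\sigma)=\mathrm{mix}(\sigma_1\cdots\sigma_{j-1})+\mathrm{mix}(\sigma_{j+1}\cdots\sigma_n)+\chi(1<j<n)$, where $\chi(\mathsf S)=1$ if the statement $\mathsf S$ is true and $0$ otherwise. Statistic $\widehat{\mathrm{drop}}$: for a cycle $C=(a_1,\dots,a_l)$ with $a_1=\min\{a_1,\dots,a_l\}$, $\widehat{\mathrm{drop}}(C)=\mathrm{mix}(a_1a_2\cdots a_l)+\chi(l>1)$; for $\sigma=C_1C_2\cdots C_k$ written as the product of its disjoint cycles (fixed points included), $\widehat{\mathrm{drop}}(\sigma)=\sum_{i=1}^k\widehat{\mathrm{drop}}(C_i)$. Normalized $\gamma$-coefficients: for $n\geq 1$ and $0\le i\le\lfloor n/2\rfloor$, $$d_{n+1,i}(\alpha,t)=\sum_{\sigma\in\mathrm{Web}_n,\ \mathrm{drop}(\sigma)=i}t^{\mathrm{fix}(\sigma)}\alpha^{\mathrm{cyc}(\sigma)}.$$ It is a known theorem of Xu and Zeng that these polynomials satisfy $A_m(x,t|\alpha)=\sum_{i=0}^{\lfloor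 (m-1)/2\rfloor}2^i d_{m,i}(\alpha,t)\,x^i(1+x)^{m-1-2i}$, where $A_m(x,t|\alpha)=\sum_{\sigma\in\mathfrak{S}_m}x^{\mathrm{des}(\sigma)}t^{\mathrm{lmidd}(\sigma)+\mathrm{rmida}(\sigma)}\alpha^{\mathrm{lmi}(\sigma)+\mathrm{rmi}(\sigma)-2}$ is the $(\alpha,t)$-Eulerian polynomial. Here $\mathrm{des}$ counts $i$ with $\sigma_i>\sigma_{i+1}$; $\mathrm{lmi}$ (resp. $\mathrm{rmi}$) counts left-to-right minima (resp. right-to-left minima), i.e. letters $\sigma_i$ with $\sigma_i<\sigma_j$ for all $j<i$ (resp. all $j>i$); and, with $\sigma_0=\sigma_{m+1}=+\infty$, $\mathrm{lmidd}$ counts left-to-right minima with $\sigma_{i-1}>\sigma_i>\sigma_{i+1}$, while $\mathrm{rmida}$ counts right-to-left minima with $\sigma_{i-1}<\sigma_i<\sigma_{i+1}$. *)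

theory Defs
  imports "HOL-Combinatorics.Combinatorics"
begin

text \<open>
  The symmetric group on \<open>[n]\<close> is rendered as the functions \<open>\<sigma>\<close> with \<open>\<sigma> permutes {1..n}\<close>, and the
  cycles of \<open>\<sigma>\<close> as its orbits on \<open>{1..n}\<close>; a fixed point \<open>i\<close> gives the orbit \<open>{i}\<close>.
\<close>

definition perm_drop :: "nat \<Rightarrow> (nat \<Rightarrow> nat) \<Rightarrow> nat" where
  "perm_drop n \<sigma> = card {i \<in> {1..n}. i > \<sigma> i}"

definition perm_fix :: "nat \<Rightarrow> (nat \<Rightarrow> nat) \<Rightarrow> nat" where
  "perm_fix n \<sigma> = card {i \<in> {1..n}. \<sigma> i = i}"

definition perm_cycles :: "nat \<Rightarrow> (nat \<Rightarrow> nat) \<Rightarrow> nat set set" where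
  "perm_cycles n \<sigma> = orbit \<sigma> ` {1..n}"

definition perm_cyc :: "nat \<Rightarrow> (nat \<Rightarrow> nat) \<Rightarrow> nat" where
  "perm_cyc n \<sigma> = card (perm_cycles n \<sigma>)"

text \<open>
  The cycle \<open>(a\<^sub>1, \<dots>, a\<^sub>k)\<close> on the orbit \<open>C\<close> with \<open>a\<^sub>1 = Min C\<close> and \<open>\<sigma> a\<^sub>i = a\<^sub>i\<^sub>+\<^sub>1\<close>:
  \<open>support \<sigma> a\<close> is the list of \<open>a, \<sigma> a, \<sigma> (\<sigma> a), \<dots>\<close> up to the first return to \<open>a\<close>.
\<close>

definition cycle_word :: "(nat \<Rightarrow> nat) \<Rightarrow> nat set \<Rightarrow> nat list" where
  "cycle_word \<sigma> C = support \<sigma> (Min C)"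

inductive andre :: "nat list \<Rightarrow> bool" where
  andre_Nil: "andre []"
| andre_split: "andre (u @ m # v)"
    if "distinct (u @ m # v)" "0 < m" "\<forall>x \<in> set u \<union> set v. m < x"
      "andre u" "andre v" "Max (set (u @ m # v)) = Max (set (m # v))"

text \<open>The predicates on cycles below take the word of the cycle starting at its minimum.\<close>

definition andre_cycle :: "nat list \<Rightarrow> bool" where
  "andre_cycle w \<longleftrightarrow> andre (tl w)"

text \<open>Web permutations, through their characterization by Hwang, Jang and Oh.\<close>

definition web_perms :: "nat \<Rightarrow> (nat \<Rightarrow> nat) set" where
  "web_perms n = {\<sigma>. \<sigma> permutes {1..n} \<and> (\<forall>C \<in> perm_cycles n \<sigma>. andre_cycle (cycle_word \<sigma> C))}"

text \<open>List positions count from 0, so the ascents of an up-down word sit at even positions.\<close>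

definition updown_cycle :: "nat list \<Rightarrow> bool" where
  "updown_cycle w \<longleftrightarrow>
     (\<forall>i. Suc i < length w \<longrightarrow> (if even i then w ! i < w ! Suc i else w ! i > w ! Suc i))"

definition cycle_updown_perms :: "nat \<Rightarrow> (nat \<Rightarrow> nat) set" where
  "cycle_updown_perms n =
     {\<sigma>. \<sigma> permutes {1..n} \<and> (\<forall>C \<in> perm_cycles n \<sigma>. updown_cycle (cycle_word \<sigma> C))}"

definition min_max_index :: "nat list \<Rightarrow> nat" where
  "min_max_index w = (LEAST j. j < length w \<and> (w ! j = Min (set w) \<or> w ! j = Max (set w)))"

lemma min_max_index_less:
  assumes "w \<noteq> []"
  shows "min_max_index w < length w"
proof -
  have "Min (set w) \<in> set w"
    using assms by simp
  then have "\<exists>j. j < length w \<and> (w ! j = Min (set w) \<or> w ! j = Max (set w))"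
    by (metis in_set_conv_nth)
  from LeastI_ex[OF this] show ?thesis
    by (simp add: min_max_index_def)
qed

text \<open>With \<open>j\<close> counted from 0, the condition \<open>1 < j < n\<close> becomes \<open>0 < j\<close> and \<open>j + 1 < n\<close>.\<close>

function mix :: "nat list \<Rightarrow> nat" where
  "mix w = (if length w \<le> 1 then 0
     else let j = min_max_index w
          in mix (take j w) + mix (drop (Suc j) w) + of_bool (0 < j \<and> Suc j < length w))"
  by pat_completeness auto
termination
proof (relation "measure length", goal_cases)
  case 1
  show ?case by simp
next
  case (2 w j)
  then have "min_max_index w < length w"
    by (intro min_max_index_less) auto
  with 2 show ?case by simp
next
  case (3 w j)
  then show ?case by simp
qed

declare mix.simps [simp del]

definition hat_drop_cycle :: "nat list \<Rightarrow> nat" where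
  "hat_drop_cycle w = mix w + of_bool (length w > 1)"

definition hat_drop :: "nat \<Rightarrow> (nat \<Rightarrow> nat) \<Rightarrow> nat" where
  "hat_drop n \<sigma> = (\<Sum>C \<in> perm_cycles n \<sigma>. hat_drop_cycle (cycle_word \<sigma> C))"

text \<open>
  The polynomial \<open>d\<^sub>m\<^sub>,\<^sub>i(\<alpha>, t)\<close> for \<open>m \<ge> 2\<close>, evaluated at elements of an arbitrary commutative
  semiring; taking indeterminates for \<open>\<alpha>\<close> and \<open>t\<close> gives the polynomial itself. The sum runs over web
  permutations of \<open>[m - 1]\<close>.
\<close>

definition gamma_coeff :: "nat \<Rightarrow> nat \<Rightarrow> 'a \<Rightarrow> 'a \<Rightarrow> 'a :: comm_semiring_1" where
  "gamma_coeff m i \<alpha> t =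
     (\<Sum>\<sigma> | \<sigma> \<in> web_perms (m - 1) \<and> perm_drop (m - 1) \<sigma> = i.
        t ^ perm_fix (m - 1) \<sigma> * \<alpha> ^ perm_cyc (m - 1) \<sigma>)"

end

theory Submission
  imports Defs
begin

text \<open>
  Everything is measured cycle by cycle. Let \<open>a\<close> be the least element of a cycle and \<open>w\<close> the rest of
  its word. The cycle is an Andre cycle iff \<open>w\<close> is an Andre word, and it then contributes
  \<open>des w + \<chi>(w \<noteq> [])\<close> drops, the last drop being the return to \<open>a\<close>. It is up-down iff \<open>w\<close> is
  alternating with an initial descent, and it then contributes \<open>mix w + \<chi>(w \<noteq> [])\<close> to the other
  statistic, because splitting \<open>a w\<close> at its first letter costs nothing. Hence it suffices to find a
  bijection from Andre words to alternating words with an initial descent which keeps the set of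
  letters and turns \<open>des\<close> into \<open>mix\<close>. Applied to every cycle it keeps the orbits, and
  so also the numbers of fixed points and of cycles, which gives the identity of polynomials.

  Both kinds of words have the same recursive structure. An Andre word is \<open>u m v\<close>, where \<open>m\<close> is the
  minimum and the maximum is not in \<open>u\<close>; here \<open>des (u m v) = des u + des v + \<chi>(u \<noteq> [])\<close>. Cut an
  alternating word \<open>u x v\<close> at its first extreme letter \<open>x\<close>. The other extreme letter is not in \<open>u\<close>
  either, so that \<open>v\<close> is nonempty unless \<open>u\<close> is empty too, and
  \<open>mix (u x v) = mix u + mix v + \<chi>(u \<noteq> [])\<close>. The parity of the length of \<open>u\<close> decides whether \<open>x\<close> sits
  on a peak or in a valley, that is, whether it is the maximum or the minimum.

  Accordingly, the word \<open>u m v\<close> is sent to the image of \<open>u\<close>, followed by \<open>m\<close> and the image of \<open>v\<close>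
  if \<open>u\<close> has odd length. For even length a maximum is needed in place of \<open>m\<close>, and an ascent after it:
  reversing the order of the letters of \<open>m v\<close> provides both, and it leaves \<open>mix\<close> unchanged. The image
  determines the length of \<open>u\<close> as the position of the first extreme letter, so the map can be
  inverted recursively (\<open>andre_to_alt_properties\<close>, \<open>andre_to_alt_inject\<close>, \<open>andre_to_alt_surj\<close>).
\<close>


section \<open>Order reversal of a finite set\<close>

text \<open>
  The order-reversing involution of \<open>Z\<close>: the \<open>i\<close>-th smallest element is exchanged with the \<open>i\<close>-th
  largest one.
\<close>

definition reversal :: "nat set \<Rightarrow> nat \<Rightarrow> nat" where
  "reversal Z x = (let l = sorted_list_of_set Z in the (map_of (zip l (rev l)) x))"

lemma reversal_nth:
  assumes "finite Z" "i < card Z"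
  shows "reversal Z (sorted_list_of_set Z ! i) = sorted_list_of_set Z ! (card Z - Suc i)"
  using assms by (simp add: reversal_def Let_def map_of_zip_nth rev_nth)

lemma elem_sorted_list_nth:
  fixes Z :: "nat set"
  assumes "finite Z" "x \<in> Z"
  obtains i where "i < card Z" "x = sorted_list_of_set Z ! i"
  using assms by (metis in_set_conv_nth length_sorted_list_of_set set_sorted_list_of_set)

lemma reversal_in:
  assumes "finite Z" "x \<in> Z"
  shows "reversal Z x \<in> Z"
proof -
  from assms obtain i where i: "i < card Z" "x = sorted_list_of_set Z ! i"
    by (rule elem_sorted_list_nth)
  have "sorted_list_of_set Z ! (card Z - Suc i) \<in> set (sorted_list_of_set Z)"
    using i by (intro nth_mem) simp
  with assms i show ?thesis by (simp add: reversal_nth)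
qed

lemma reversal_reversal:
  assumes "finite Z" "x \<in> Z"
  shows "reversal Z (reversal Z x) = x"
proof -
  from assms obtain i where "i < card Z" "x = sorted_list_of_set Z ! i"
    by (rule elem_sorted_list_nth)
  with assms(1) show ?thesis by (simp add: reversal_nth)
qed

lemma reversal_strict_antimono:
  assumes Z: "finite Z"
  shows "strict_antimono_on Z (reversal Z)"
proof (rule monotone_onI)
  fix x y assume xy: "x \<in> Z" "y \<in> Z" "x < y"
  let ?l = "sorted_list_of_set Z"
  obtain i where i: "i < card Z" "x = ?l ! i" using Z xy(1) by (rule elem_sorted_list_nth)
  obtain j where j: "j < card Z" "y = ?l ! j" using Z xy(2) by (rule elem_sorted_list_nth)
  have "sorted ?l" by simp
  then have "i < j"
    using i j xy(3) by (metis leD le_less_linear length_sorted_list_of_set sorted_nth_mono)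
  then have "?l ! (card Z - Suc j) < ?l ! (card Z - Suc i)"
    using j(1) by (intro sorted_wrt_nth_less[OF strict_sorted_list_of_set]) auto
  with Z i j show "reversal Z x > reversal Z y" by (simp add: reversal_nth)
qed

lemma reversal_image:
  assumes "finite Z"
  shows "reversal Z ` Z = Z"
proof -
  have "x \<in> reversal Z ` Z" if "x \<in> Z" for x
    using assms that reversal_in reversal_reversal by (metis imageI)
  with assms show ?thesis by (auto simp: reversal_in)
qed

lemma strict_antimono_on_inj_on:
  fixes f :: "nat \<Rightarrow> nat"
  assumes "strict_antimono_on A f"
  shows "inj_on f A"
proof (rule inj_onI)
  fix x y assume "x \<in> A" "y \<in> A" "f x = f y"
  then show "x = y"
    using monotone_onD[OF assms, of x y] monotone_onD[OF assms, of y x] by fastforce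
qed

lemma strict_antimono_on_Min_Max:
  fixes f :: "nat \<Rightarrow> nat"
  assumes "strict_antimono_on A f" "finite A" "A \<noteq> {}"
  shows "Min (f ` A) = f (Max A)" "Max (f ` A) = f (Min A)"
proof -
  have *: "x \<in> A \<Longrightarrow> y \<in> A \<Longrightarrow> x \<le> y \<Longrightarrow> f y \<le> f x" for x y
    using monotone_onD[OF assms(1), of x y] by (cases "x = y") auto
  show "Min (f ` A) = f (Max A)" "Max (f ` A) = f (Min A)"
    using assms by (auto intro!: Min_eqI Max_eqI * imageI Max_in Min_in)
qed

lemma reversal_Min: "finite Z \<Longrightarrow> Z \<noteq> {} \<Longrightarrow> reversal Z (Min Z) = Max Z"
  using strict_antimono_on_Min_Max(2)[OF reversal_strict_antimono] by (simp add: reversal_image)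

lemma reversal_Max: "finite Z \<Longrightarrow> Z \<noteq> {} \<Longrightarrow> reversal Z (Max Z) = Min Z"
  using strict_antimono_on_Min_Max(1)[OF reversal_strict_antimono] by (simp add: reversal_image)

lemma map_reversal_reversal:
  "finite Z \<Longrightarrow> set w \<subseteq> Z \<Longrightarrow> map (reversal Z) (map (reversal Z) w) = w"
  by (auto simp: reversal_reversal subset_iff intro: map_idI)


section \<open>Splitting a word at its first extreme letter\<close>

text \<open>
  The recursion of \<open>mix\<close> cuts a word at its first minimum or maximum. Stating this on the three parts
  of the word, without positions, makes it stable under order-reversing relabelling.
\<close>

definition first_extreme :: "nat list \<Rightarrow> nat \<Rightarrow> nat list \<Rightarrow> bool" where
  "first_extreme u x v \<longleftrightarrow>
     (let S = set (u @ x # v) in x \<in> {Min S, Max S} \<and> Min S \<notin> set u \<and> Max S \<notin> set u)"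

lemma first_extreme_split:
  assumes "w \<noteq> []"
  obtains u x v where "w = u @ x # v" "first_extreme u x v"
proof -
  have "\<exists>x\<in>set w. x = Min (set w) \<or> x = Max (set w)"
    using assms by (intro bexI[of _ "Min (set w)"]) auto
  then obtain u x v where "w = u @ x # v" "x = Min (set w) \<or> x = Max (set w)"
    "\<forall>y\<in>set u. \<not> (y = Min (set w) \<or> y = Max (set w))"
    by (rule split_list_first_propE)
  then show thesis by (intro that) (auto simp: first_extreme_def Let_def)
qed

lemma first_extreme_index:
  assumes "first_extreme u x v"
  shows "min_max_index (u @ x # v) = length u"
  unfolding min_max_index_def
proof (rule Least_equality)
  fix j assume j: "j < length (u @ x # v) \<and> ((u @ x # v) ! j = Min (set (u @ x # v)) \<or>
       (u @ x # v) ! j = Max (set (u @ x # v)))"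
  show "length u \<le> j"
  proof (rule ccontr)
    assume "\<not> length u \<le> j"
    then have "(u @ x # v) ! j \<in> set u" by (simp add: nth_append)
    with assms j show False by (auto simp: first_extreme_def Let_def)
  qed
qed (use assms in \<open>auto simp: first_extreme_def Let_def\<close>)

lemma mix_Nil [simp]: "mix [] = 0"
  by (simp add: mix.simps)

lemma mix_first_extreme:
  assumes "first_extreme u x v"
  shows "mix (u @ x # v) = mix u + mix v + of_bool (u \<noteq> [] \<and> v \<noteq> [])"
proof (cases "u = [] \<and> v = []")
  case True
  then show ?thesis by (simp add: mix.simps)
next
  case False
  then have "\<not> length (u @ x # v) \<le> 1" by (auto simp: Suc_le_eq)
  then show ?thesis
    by (subst mix.simps) (simp add: first_extreme_index[OF assms] Let_def)
qed

text \<open>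
  Reversing the order exchanges minimum and maximum, so the first extreme letter keeps its position.
  This is the reason for the invariance of \<open>mix\<close> proved next.
\<close>

lemma first_extreme_map:
  assumes f: "strict_antimono_on (set (u @ x # v)) f" and "first_extreme u x v"
  shows "first_extreme (map f u) (f x) (map f v)"
proof -
  let ?S = "set (u @ x # v)"
  have eq: "set (map f u @ f x # map f v) = f ` ?S" by auto
  have mm: "Min (f ` ?S) = f (Max ?S)" "Max (f ` ?S) = f (Min ?S)"
    using strict_antimono_on_Min_Max[OF f] by auto
  have "f y \<in> f ` set u \<longleftrightarrow> y \<in> set u" if "y \<in> ?S" for y
    by (rule inj_on_image_mem_iff[OF strict_antimono_on_inj_on[OF f] that]) auto
  moreover have "Min ?S \<in> ?S" "Max ?S \<in> ?S" by (rule Min_in Max_in; simp)+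
  ultimately show ?thesis
    using assms(2) unfolding first_extreme_def Let_def eq mm by auto
qed

lemma mix_map_antimono: "strict_antimono_on (set w) f \<Longrightarrow> mix (map f w) = mix w"
proof (induction w rule: length_induct)
  case (1 w)
  show ?case
  proof (cases "w = []")
    case False
    then obtain u x v where w: "w = u @ x # v" and fe: "first_extreme u x v"
      by (rule first_extreme_split)
    have sub: "strict_antimono_on (set u) f" "strict_antimono_on (set v) f"
      using 1(2) unfolding w by (auto intro: monotone_on_subset)
    have "mix (map f w) = mix (map f u) + mix (map f v) + of_bool (u \<noteq> [] \<and> v \<noteq> [])"
      using mix_first_extreme[OF first_extreme_map[OF 1(2)[unfolded w] fe]] by (simp add: w)
    also have "\<dots> = mix w"
      using 1(1) sub mix_first_extreme[OF fe] by (simp add: w)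
    finally show ?thesis .
  qed simp
qed


section \<open>Alternating words\<close>

fun alternates :: "bool \<Rightarrow> nat list \<Rightarrow> bool" where
  "alternates up (x # y # w) \<longleftrightarrow> (if up then x < y else y < x) \<and> alternates (\<not> up) (y # w)"
| "alternates up _ \<longleftrightarrow> True"

lemma all_nat_iff_zero_Suc: "(\<forall>i::nat. P i) \<longleftrightarrow> P 0 \<and> (\<forall>i. P (Suc i))"
  by (metis not0_implies_Suc)

lemma alternates_nth:
  "alternates up w \<longleftrightarrow>
     (\<forall>i. Suc i < length w \<longrightarrow> (if even i = up then w ! i < w ! Suc i else w ! Suc i < w ! i))"
proof (induction up w rule: alternates.induct)
  case (1 up x y w)
  show ?case
    unfolding alternates.simps 1
    by (subst (2) all_nat_iff_zero_Suc) auto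
qed auto

lemma updown_cycle_iff: "updown_cycle w \<longleftrightarrow> alternates True w"
  by (simp add: updown_cycle_def alternates_nth)

lemma alternates_Cons:
  "alternates up (x # w) \<longleftrightarrow>
     (w \<noteq> [] \<longrightarrow> (if up then x < hd w else hd w < x)) \<and> alternates (\<not> up) w"
  by (cases w) auto

text \<open>
  The Boolean at the position of \<open>x\<close> is \<open>up = even (length u)\<close>: if it holds then an ascent
  starts at \<open>x\<close>, so \<open>x\<close> is a valley and lies below the letter in front of it.
\<close>

lemma alternates_append:
  "alternates up (u @ x # v) \<longleftrightarrow>
     alternates up u \<and> alternates (up = even (length u)) (x # v) \<and>
     (u \<noteq> [] \<longrightarrow> (if up = even (length u) then last u > x else last u < x))"
proof (induction u arbitrary: up)
  case (Cons a u)
  have "((\<not> up) = even (length u)) = (up = even (length (a # u)))" by auto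
  with Cons[of "\<not> up"] show ?case
    by (cases "u = []"; cases up) (simp_all add: alternates_Cons[of _ a] hd_append conj_ac del: even_Suc)
qed simp

lemma alternates_map_antimono:
  "strict_antimono_on (set w) f \<Longrightarrow> alternates up (map f w) \<longleftrightarrow> alternates (\<not> up) w"
proof (induction up w rule: alternates.induct)
  case (1 up x y w)
  have sub: "strict_antimono_on (set (y # w)) f"
    using 1(2) by (rule monotone_on_subset) auto
  have "f a < f b \<longleftrightarrow> b < a" if "a \<in> {x, y}" "b \<in> {x, y}" for a b
    using that monotone_onD[OF 1(2), of a b] monotone_onD[OF 1(2), of b a]
    by (cases a b rule: linorder_cases) auto
  with 1(1)[OF sub] show ?case by simp
qed auto


section \<open>From Andre words to alternating words\<close>

fun des :: "nat list \<Rightarrow> nat" where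
  "des (x # y # w) = of_bool (y < x) + des (y # w)"
| "des _ = 0"

text \<open>
  The minimum is preceded by a descent, unless it comes first, and it is never followed by one.
\<close>

lemma des_append_min:
  assumes "\<forall>x\<in>set u \<union> set v. m < x"
  shows "des (u @ m # v) = des u + des v + of_bool (u \<noteq> [])"
  using assms by (induction u rule: des.induct; cases v) auto

text \<open>
  Cut at the minimum \<open>m\<close>. A first part of odd length must be followed by a valley, so \<open>m\<close> may stay. A
  first part of even length must be followed by a peak; since \<open>m\<close> is the least letter of \<open>m v\<close> and the
  overall maximum occurs in \<open>m v\<close>, the order reversal on the letters of \<open>m v\<close> turns \<open>m\<close> into that
  maximum and exchanges ascents with descents behind it.
\<close>

function andre_to_alt :: "nat list \<Rightarrow> nat list" where
  "andre_to_alt w =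
     (if w = [] then []
      else let m = Min (set w); u = takeWhile (\<lambda>x. x \<noteq> m) w; v = tl (dropWhile (\<lambda>x. x \<noteq> m) w)
           in andre_to_alt u @
              (if even (length u) then map (reversal (set (m # v))) else id) (m # andre_to_alt v))"
  by pat_completeness auto
termination
proof (relation "measure length", goal_cases)
  case (2 w m u)
  then have "dropWhile (\<lambda>x. x \<noteq> m) w \<noteq> []" by simp
  then have "length u < length (takeWhile (\<lambda>x. x \<noteq> m) w @ dropWhile (\<lambda>x. x \<noteq> m) w)"
    unfolding 2 length_append by simp
  then show ?case by simp
next
  case (3 w m u v)
  have "length v \<le> length w - 1" unfolding 3 by (simp add: length_dropWhile_le diff_le_mono)
  with 3(1) show ?case by (cases w) auto
qed simp

declare andre_to_alt.simps [simp del]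

lemma andre_to_alt_Nil [simp]: "andre_to_alt [] = []"
  by (simp add: andre_to_alt.simps)

lemma andre_to_alt_split:
  assumes "\<forall>x\<in>set u \<union> set v. m < x"
  shows "andre_to_alt (u @ m # v) = andre_to_alt u @
    (if even (length u) then map (reversal (set (m # v))) else id) (m # andre_to_alt v)"
proof -
  have "Min (set (u @ m # v)) = m"
    using assms by (intro Min_eqI) (auto intro: less_imp_le)
  moreover have "takeWhile (\<lambda>x. x \<noteq> m) (u @ m # v) = u" "dropWhile (\<lambda>x. x \<noteq> m) (u @ m # v) = m # v"
    using assms by (auto simp: takeWhile_append dropWhile_append)
  ultimately show ?thesis
    by (subst andre_to_alt.simps) (simp only: Let_def list.sel, simp)
qed

lemma andre_distinct: "andre w \<Longrightarrow> distinct w"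
  by (cases rule: andre.cases) auto

text \<open>
  The conditions for joining two Andre words at \<open>m\<close>. Separated from the recursion, they allow the
  next lemma to speak of all words with the letters of \<open>u\<close> and \<open>v\<close>, the images included.
\<close>

definition andre_node :: "nat list \<Rightarrow> nat \<Rightarrow> nat list \<Rightarrow> bool" where
  "andre_node u m v \<longleftrightarrow> distinct (u @ m # v) \<and> 0 < m \<and> (\<forall>x\<in>set u \<union> set v. m < x) \<and>
     Max (set (u @ m # v)) = Max (set (m # v))"

text \<open>
  In both shapes which the image of \<open>u m v\<close> can take, the letter after the image of \<open>u\<close> is the first
  extreme one: neither the minimum \<open>m\<close> nor the overall maximum occurs in \<open>u\<close>, and the reversal does not
  change the set of letters of \<open>m v\<close>.
\<close>

lemma first_extreme_andre:
  assumes node: "andre_node u m v" and u': "set u' = set u" and v': "set v' = set v"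
  shows "first_extreme u' m v'"
    and "first_extreme u' (Max (set (m # v))) (map (reversal (set (m # v))) v')"
proof -
  let ?Z = "set (m # v)"
  have Min: "Min (set u \<union> ?Z) = m" "Min ?Z = m"
    using node by (auto simp: andre_node_def intro!: Min_eqI intro: less_imp_le)
  have Max: "Max (set u \<union> ?Z) = Max ?Z"
    using node by (simp add: andre_node_def)
  have "Max ?Z \<in> ?Z" by (rule Max_in) simp_all
  then have notin: "m \<notin> set u'" "Max ?Z \<notin> set u'"
    using node u' unfolding andre_node_def by fastforce+
  have S: "set (u' @ m # v') = set u \<union> ?Z" using u' v' by auto
  show "first_extreme u' m v'"
    unfolding first_extreme_def Let_def S Min Max using notin by blast
  have "reversal ?Z ` ?Z = ?Z" by (rule reversal_image) simp
  moreover have "reversal ?Z m = Max ?Z" using reversal_Min[of ?Z] Min(2) by simp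
  ultimately have "insert (Max ?Z) (reversal ?Z ` set v) = ?Z" by (metis image_insert list.simps(15))
  then have S: "set (u' @ Max ?Z # map (reversal ?Z) v') = set u \<union> ?Z"
    using u' v' by (metis list.simps(15) set_append set_map)
  show "first_extreme u' (Max ?Z) (map (reversal ?Z) v')"
    unfolding first_extreme_def Let_def S Min Max using notin by blast
qed

lemma reversal_min_letter:
  assumes "\<forall>x\<in>set v. m < x"
  shows "reversal (set (m # v)) m = Max (set (m # v))"
proof -
  have "Min (set (m # v)) = m" using assms by (intro Min_eqI) (auto intro: less_imp_le)
  then show ?thesis using reversal_Min[of "set (m # v)"] by simp
qed

text \<open>
  Along the recursion, the descent in front of the minimum of an Andre word corresponds to the unit
  that \<open>mix\<close> gains when the first extreme letter is an inner one. For the two to agree, \<open>v\<close> must be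
  nonempty whenever \<open>u\<close> is; this holds because the maximum occurs in \<open>m v\<close> and exceeds \<open>m\<close>.
\<close>

lemma andre_to_alt_properties:
  assumes "andre w"
  shows "set (andre_to_alt w) = set w \<and> distinct (andre_to_alt w) \<and>
         alternates False (andre_to_alt w) \<and> mix (andre_to_alt w) = des w"
  using assms
proof induction
  case andre_Nil
  show ?case by simp
next
  case (andre_split u m v)
  let ?Z = "set (m # v)" and ?Fu = "andre_to_alt u" and ?Fv = "andre_to_alt v"
  let ?r = "reversal ?Z"
  have node: "andre_node u m v" using andre_split by (auto simp: andre_node_def)
  have F: "andre_to_alt (u @ m # v) = ?Fu @ (if even (length u) then map ?r else id) (m # ?Fv)"
    using andre_split(3) by (rule andre_to_alt_split)
  have anti: "strict_antimono_on ?Z ?r" by (rule reversal_strict_antimono) simp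
  have sets: "set ?Fu = set u" "set ?Fv = set v" using andre_split by auto
  have len: "length ?Fu = length u"
    using andre_split by (metis distinct_card andre_distinct)
  have inv_r: "set (map ?r (m # ?Fv)) = ?Z"
    using reversal_image[of ?Z] sets by simp
  have dist_r: "distinct (map ?r (m # ?Fv))"
    using strict_antimono_on_inj_on[OF anti] andre_split sets by (subst distinct_map) auto
  have rm: "?r m = Max ?Z" using andre_split(3) by (intro reversal_min_letter) auto
  have up: "alternates True (m # ?Fv)"
    using andre_split sets by (auto simp: alternates_Cons)
  have des: "des (u @ m # v) = des u + des v + of_bool (u \<noteq> [])"
    using andre_split(3) by (rule des_append_min)
  have nodemix: "mix ?Fu + mix ?Fv + of_bool (?Fu \<noteq> [] \<and> ?Fv \<noteq> []) = des (u @ m # v)"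
  proof -
    \<comment> \<open>If \<open>v\<close> were empty, then \<open>m\<close> would be the maximum, but the letters of \<open>u\<close> are larger.\<close>
    have "v \<noteq> []" if "u \<noteq> []"
    proof
      assume "v = []"
      then have "Max (set (u @ [m])) = m" using andre_split(6) by simp
      moreover have "hd u \<le> Max (set (u @ [m]))" "m < hd u" using that andre_split(3) by auto
      ultimately show False by simp
    qed
    moreover have "?Fu = [] \<longleftrightarrow> u = []" "?Fv = [] \<longleftrightarrow> v = []"
      using sets by (metis set_empty)+
    moreover have "mix ?Fu = des u" "mix ?Fv = des v" using andre_split by auto
    ultimately show ?thesis unfolding des by auto
  qed
  have disj: "set ?Fu \<inter> ?Z = {}" using andre_split(1) sets by auto
  show ?case
  proof (cases "even (length u)")
    case True
    have F: "andre_to_alt (u @ m # v) = ?Fu @ map ?r (m # ?Fv)"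
      using True unfolding F by (simp only: if_True)
    have F': "andre_to_alt (u @ m # v) = ?Fu @ Max ?Z # map ?r ?Fv"
      unfolding F list.map rm ..
    have "set (andre_to_alt (u @ m # v)) = set (u @ m # v)"
      unfolding F set_append inv_r sets ..
    moreover have "distinct (andre_to_alt (u @ m # v))"
      unfolding F distinct_append inv_r using disj dist_r andre_split by blast
    moreover have "alternates False (andre_to_alt (u @ m # v))"
      unfolding F' alternates_append
    proof (intro conjI impI)
      show "alternates False ?Fu" using andre_split by blast
      have "alternates False (map ?r (m # ?Fv))"
        using up anti sets by (subst alternates_map_antimono) auto
      then show "alternates (False = even (length ?Fu)) (Max ?Z # map ?r ?Fv)"
        using True unfolding len list.map rm by simp
      assume "?Fu \<noteq> []"
      then have l: "last ?Fu \<in> set u" using sets by (metis last_in_set)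
      then have "last ?Fu \<le> Max (set (u @ m # v))" by (intro Max_ge) auto
      moreover have "Max ?Z \<in> ?Z" by (rule Max_in) simp_all
      then have "last ?Fu \<noteq> Max ?Z" using l disj sets by fastforce
      ultimately have "last ?Fu < Max ?Z" unfolding andre_split(6) by (rule le_neq_trans)
      then show "if False = even (length ?Fu) then Max ?Z < last ?Fu else last ?Fu < Max ?Z"
        using True unfolding len by simp
    qed
    moreover have "mix (map ?r ?Fv) = mix ?Fv"
      using sets by (intro mix_map_antimono monotone_on_subset[OF anti]) auto
    then have "mix (andre_to_alt (u @ m # v)) = des (u @ m # v)"
      using mix_first_extreme[OF first_extreme_andre(2)[OF node sets]] nodemix
      unfolding F' map_is_Nil_conv by (simp only:)
    ultimately show ?thesis by blast
  next
    case False
    have F: "andre_to_alt (u @ m # v) = ?Fu @ m # ?Fv"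
      using False unfolding F by (simp only: if_False id_apply)
    have "?Fu \<noteq> [] \<Longrightarrow> m < last ?Fu" using sets andre_split(3) by (metis UnI1 last_in_set)
    with False up andre_split have "alternates False (?Fu @ m # ?Fv)"
      by (simp add: alternates_append len)
    moreover have "mix (andre_to_alt (u @ m # v)) = des (u @ m # v)"
      using mix_first_extreme[OF first_extreme_andre(1)[OF node sets]] nodemix
      unfolding F by (simp only:)
    moreover have "distinct (?Fu @ m # ?Fv)" using andre_split sets by auto
    ultimately show ?thesis
      using sets by (simp add: F)
  qed
qed

text \<open>
  The cut of \<open>u m v\<close> can be read off from its image. Injectivity rests on this.
\<close>

lemma andre_to_alt_index:
  assumes node: "andre_node u m v" and "andre u" "andre v"
  shows "min_max_index (andre_to_alt (u @ m # v)) = length (andre_to_alt u)"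
proof -
  note F = andre_to_alt_split[of u v m]
  have gt: "\<forall>x\<in>set u \<union> set v. m < x" using node by (auto simp: andre_node_def)
  have sets: "set (andre_to_alt u) = set u" "set (andre_to_alt v) = set v"
    using assms andre_to_alt_properties by auto
  have "reversal (set (m # v)) m = Max (set (m # v))"
    using gt by (intro reversal_min_letter) auto
  then show ?thesis
    unfolding F[OF gt]
    using first_extreme_index[OF first_extreme_andre(1)[OF node sets]]
      first_extreme_index[OF first_extreme_andre(2)[OF node sets]]
    by (cases "even (length u)") (simp_all only: if_True if_False id_apply list.map)
qed

text \<open>
  Equal images are cut at the same position by \<open>andre_to_alt_index\<close> and have the same set of letters.
  The first parts therefore agree by induction; as the minimum and the letters of the last parts agree
  as well, so does the reversal that may have been applied to the last parts, and it can be undone.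
\<close>

lemma andre_to_alt_inject:
  assumes "andre w" "andre w'" "andre_to_alt w = andre_to_alt w'"
  shows "w = w'"
  using assms
proof (induction arbitrary: w')
  case andre_Nil
  then show ?case using andre_to_alt_properties[of w'] by simp
next
  case (andre_split u m v)
  have set_eq: "set w' = set (u @ m # v)"
    using andre_split.prems andre.andre_split[OF andre_split.hyps] by (metis andre_to_alt_properties)
  from andre_split.prems(1) show ?case
  proof cases
    case andre_Nil
    with set_eq show ?thesis by simp
  next
    case w': (andre_split u' m' v')
    have nodes: "andre_node u m v" "andre_node u' m' v'"
      using andre_split.hyps w' by (auto simp: andre_node_def)
    let ?T = "\<lambda>u m v. (if even (length u) then map (reversal (set (m # v))) else id) (m # andre_to_alt v)"
    have F: "andre_to_alt (u @ m # v) = andre_to_alt u @ ?T u m v"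
      "andre_to_alt w' = andre_to_alt u' @ ?T u' m' v'"
      using andre_split.hyps(3) w' by (simp_all only: andre_to_alt_split)
    have "length (andre_to_alt u) = length (andre_to_alt u')"
      using andre_to_alt_index nodes andre_split.hyps andre_split.prems(2) w' by metis
    then have "andre_to_alt u = andre_to_alt u' \<and> ?T u m v = ?T u' m' v'"
      using andre_split.prems(2) unfolding F by (subst (asm) append_eq_append_conv) (rule disjI1)
    then have eqs: "andre_to_alt u = andre_to_alt u'" "?T u m v = ?T u' m' v'" by blast+
    have u: "u = u'" using andre_split.IH(1) eqs(1) w' by blast
    have "Min (set (u @ m # v)) = m" "Min (set w') = m'"
      using nodes w'(1) by (auto simp: andre_node_def intro!: Min_eqI intro: less_imp_le)
    then have m: "m = m'" using set_eq by simp
    have v: "set v = set v'" using set_eq nodes u m w'(1) by (auto simp: andre_node_def)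
    let ?Z = "set (m # v)"
    have sub: "set (m # andre_to_alt v) \<subseteq> ?Z" "set (m # andre_to_alt v') \<subseteq> ?Z"
      using andre_to_alt_properties[of v] andre_to_alt_properties[of v'] andre_split.hyps w' v by auto
    have "m # andre_to_alt v = m # andre_to_alt v'"
    proof (cases "even (length u)")
      case True
      then have "map (reversal ?Z) (m # andre_to_alt v) = map (reversal ?Z) (m # andre_to_alt v')"
        using eqs(2) unfolding u m v list.set by (simp only: if_True)
      then show ?thesis
        using map_reversal_reversal[of ?Z] sub by (metis finite_set)
    next
      case False
      then show ?thesis using eqs(2) unfolding u m by (simp only: if_False id_apply)
    qed
    then have "v = v'" using andre_split.IH(2) w' by blast
    with u m w'(1) show ?thesis by simp
  qed
qed

text \<open>
  The condition on the maximum holds as soon as one letter \<open>h\<close> of \<open>m v\<close> bounds all letters of \<open>u\<close>.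
\<close>

lemma andre_nodeI:
  assumes "andre u" "andre v" "0 < m" "\<forall>x\<in>set u \<union> set v. m < x" "set u \<inter> set v = {}"
    and h: "h \<in> set (m # v)" "\<forall>y\<in>set u. y \<le> h"
  shows "andre (u @ m # v)"
proof (rule andre.andre_split)
  show "distinct (u @ m # v)" using assms by (auto simp: andre_distinct)
  have h_le: "h \<le> Max (set (m # v))" using h(1) by (intro Max_ge) simp_all
  have "Max (set (m # v)) \<in> set (m # v)" by (rule Max_in) simp_all
  moreover have "y \<le> Max (set (m # v))" if "y \<in> set (u @ m # v)" for y
  proof (cases "y \<in> set u")
    case True
    then show ?thesis using h(2) h_le by (blast intro: order_trans)
  next
    case False
    with that show ?thesis by (intro Max_ge) auto
  qed
  ultimately show "Max (set (u @ m # v)) = Max (set (m # v))"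
    by (intro Max_eqI) (auto simp del: Max_insert)
qed (use assms in blast)+

text \<open>
  Cut an alternating word with an initial descent at its first extreme letter \<open>x\<close>. If \<open>u\<close> has odd
  length, then \<open>x\<close> is a valley, hence the minimum, and preimages of \<open>u\<close> and \<open>v\<close> are joined at \<open>x\<close>. If
  the length is even, then \<open>x\<close> is a peak, hence the maximum, and the reversal on the letters of \<open>x v\<close>
  is applied first: it turns \<open>x\<close> into the minimum and \<open>v\<close> into a word with an initial descent.
\<close>

lemma andre_to_alt_surj:
  "distinct d \<Longrightarrow> alternates False d \<Longrightarrow> 0 \<notin> set d \<Longrightarrow> \<exists>w. andre w \<and> andre_to_alt w = d"
proof (induction d rule: length_induct)
  case (1 d)
  show ?case
  proof (cases "d = []")
    case True
    then show ?thesis by (intro exI[of _ "[]"]) (simp add: andre_Nil)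
  next
    case False
    then obtain u x v where d: "d = u @ x # v" and fe: "first_extreme u x v"
      by (rule first_extreme_split)
    let ?Z = "set (x # v)"
    let ?S = "set u \<union> ?Z"
    have S: "set (u @ x # v) = ?S" by simp
    obtain lo hi where lo: "lo = Min ?S" and hi: "hi = Max ?S" by blast
    have x: "x = lo \<or> x = hi" and notin: "lo \<notin> set u" "hi \<notin> set u"
      using fe unfolding first_extreme_def Let_def S lo hi by auto
    have inS: "lo \<in> ?S" "hi \<in> ?S" unfolding lo hi by (rule Min_in Max_in; simp)+
    \<comment> \<open>Whichever extreme \<open>x\<close> is, the other one comes after it.\<close>
    then have inZ: "lo \<in> ?Z" "hi \<in> ?Z" using notin by blast+
    have alt: "alternates False u" "alternates (odd (length u)) (x # v)"
      "u \<noteq> [] \<Longrightarrow> if odd (length u) then x < last u else last u < x"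
      using 1(3) unfolding d alternates_append by simp_all
    have disj: "set u \<inter> ?Z = {}" using 1(2) unfolding d by auto
    have pos: "0 < lo" using 1(4) inS(1) unfolding d S by (metis gr0I)
    have le_hi: "y \<le> hi" and lo_le: "lo \<le> y" if "y \<in> ?S" for y
      using that unfolding lo hi by simp_all
    have IH: "\<exists>w. andre w \<and> andre_to_alt w = e"
      if "length e < length d" "distinct e" "alternates False e" "0 \<notin> set e" for e
      using 1(1) that by blast
    obtain w1 where w1: "andre w1" "andre_to_alt w1 = u"
      using IH[of u] 1(2,4) alt(1) unfolding d by auto
    have set_w1: "set w1 = set u" and len_w1: "length w1 = length u"
      using andre_to_alt_properties[OF w1(1)] andre_distinct[OF w1(1)] w1(2)
      by (auto simp flip: distinct_card)
    show ?thesis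
    proof (cases "odd (length u)")
      case True
      then have "u \<noteq> []" by auto
      then have "x < last u" "last u \<in> ?S" using alt(3) True by simp_all
      then have x: "x = lo" using x le_hi[of "last u"] by auto
      have "alternates False v" using alt(2) True by (simp add: alternates_Cons)
      then obtain w2 where w2: "andre w2" "andre_to_alt w2 = v"
        using IH[of v] 1(2,4) unfolding d by auto
      have set_w2: "set w2 = set v" using andre_to_alt_properties[OF w2(1)] w2(2) by simp
      then have Z: "set (x # w2) = ?Z" by simp
      have gt: "\<forall>y\<in>set w1 \<union> set w2. x < y"
      proof
        fix y assume y: "y \<in> set w1 \<union> set w2"
        then have "y \<noteq> x" using set_w1 set_w2 1(2) unfolding d by auto
        moreover have "y \<in> ?S" using y set_w1 Z by auto
        ultimately show "x < y" using lo_le[of y] x by simp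
      qed
      have "andre (w1 @ x # w2)"
      proof (rule andre_nodeI[OF w1(1) w2(1) _ gt])
        show "set w1 \<inter> set w2 = {}" using set_w1 Z disj by auto
        show "hi \<in> set (x # w2)" unfolding Z using inZ by simp
      qed (use pos x le_hi set_w1 in simp_all)
      moreover from andre_to_alt_split[OF gt] have "andre_to_alt (w1 @ x # w2) = d"
        unfolding d using True by (simp add: len_w1 w1 w2)
      ultimately show ?thesis by blast
    next
      case False
      have x: "x = hi"
      proof (rule ccontr)
        \<comment> \<open>A minimum on a peak has no neighbours, so it is the only letter and also the maximum.\<close>
        assume "x \<noteq> hi"
        then have lt: "\<And>y. y \<in> ?S \<Longrightarrow> x \<le> y" using x lo_le by simp
        have "u = []" using alt(3) False lt[of "last u"] by fastforce
        moreover have "v = []" using alt(2) False lt[of "hd v"] by (fastforce simp: alternates_Cons)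
        ultimately show False using \<open>x \<noteq> hi\<close> inZ(2) by simp
      qed
      let ?r = "reversal ?Z"
      have anti: "strict_antimono_on ?Z ?r" by (rule reversal_strict_antimono) simp
      have "Min ?Z = lo" by (rule Min_eqI) (use inZ lo_le in auto)
      moreover have "Max ?Z = x" by (rule Max_eqI) (use le_hi in \<open>auto simp flip: x\<close>)
      ultimately have mZ: "Min ?Z = lo" "Max ?Z = x" .
      have rx: "?r x = lo" using reversal_Max[of ?Z] unfolding mZ by simp
      then have rZ: "insert lo (?r ` set v) = ?Z"
        using reversal_image[of ?Z] by (metis finite_set image_insert list.simps(15))
      have "distinct (map ?r (x # v))"
        using strict_antimono_on_inj_on[OF anti] 1(2) unfolding d distinct_map by auto
      then have dist: "distinct (map ?r v)" "lo \<notin> set (map ?r v)" unfolding list.map rx by auto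
      have "alternates True (map ?r (x # v))"
        using alt(2) False anti by (subst alternates_map_antimono) auto
      then have altv: "alternates False (map ?r v)" unfolding list.map by (simp add: alternates_Cons)
      have "0 \<notin> set (map ?r v)" using rZ 1(4) unfolding d by auto
      then obtain w2 where w2: "andre w2" "andre_to_alt w2 = map ?r v"
        using IH[of "map ?r v"] dist(1) altv unfolding d length_map by auto
      have set_w2: "set w2 = set (map ?r v)" using andre_to_alt_properties[OF w2(1)] w2(2) by simp
      then have Z: "set (lo # w2) = ?Z" using rZ unfolding list.set by simp
      have gt: "\<forall>y\<in>set w1 \<union> set w2. lo < y"
      proof
        fix y assume y: "y \<in> set w1 \<union> set w2"
        then have "y \<noteq> lo" using set_w1 set_w2 notin dist(2) by auto
        moreover have "y \<in> ?S" using y set_w1 Z by auto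
        ultimately show "lo < y" using lo_le[of y] by simp
      qed
      have w: "andre (w1 @ lo # w2)"
      proof (rule andre_nodeI[OF w1(1) w2(1) pos gt])
        show "set w1 \<inter> set w2 = {}" using set_w1 Z disj by auto
        show "hi \<in> set (lo # w2)" unfolding Z using inZ by simp
      qed (use le_hi set_w1 in simp_all)
      from andre_to_alt_split[OF gt]
      have "andre_to_alt (w1 @ lo # w2) = u @ map ?r (lo # map ?r v)"
        using False unfolding Z len_w1 w1 w2 by (simp only: if_True simp_thms not_not)
      also have "\<dots> = u @ map ?r (map ?r (x # v))" unfolding list.map rx ..
      also have "\<dots> = d" unfolding d by (subst map_reversal_reversal) auto
      finally show ?thesis using w by blast
    qed
  qed
qed


section \<open>Words of cycles\<close>

text \<open>
  The words that represent cycles, each cycle by exactly one of them.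
\<close>

definition min_first :: "nat list \<Rightarrow> bool" where
  "min_first w \<longleftrightarrow> w \<noteq> [] \<and> distinct w \<and> hd w = Min (set w)"

lemma min_first_Cons: "min_first (a # v) \<longleftrightarrow> distinct v \<and> (\<forall>x\<in>set v. a < x)"
proof -
  have "a = Min (set (a # v)) \<longleftrightarrow> (\<forall>x\<in>set v. a \<le> x)"
    unfolding eq_commute[of a] by (subst Min_eq_iff) auto
  then show ?thesis unfolding min_first_def by (auto simp: less_le simp del: Min_insert)
qed

definition andre_to_updown_cycle :: "nat list \<Rightarrow> nat list" where
  "andre_to_updown_cycle w = hd w # andre_to_alt (tl w)"

lemma updown_cycle_Cons: "min_first (a # v) \<Longrightarrow> updown_cycle (a # v) \<longleftrightarrow> alternates False v"
  by (auto simp: updown_cycle_iff alternates_Cons min_first_Cons)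

lemma set_andre_to_updown_cycle:
  "min_first w \<Longrightarrow> andre_cycle w \<Longrightarrow> set (andre_to_updown_cycle w) = set w"
  by (cases w)
    (auto simp: andre_to_updown_cycle_def andre_cycle_def min_first_def andre_to_alt_properties)

lemma bij_betw_andre_to_updown_cycle:
  "bij_betw andre_to_updown_cycle {w. min_first w \<and> andre_cycle w} {w. min_first w \<and> updown_cycle w}"
proof (rule bij_betw_imageI)
  show "inj_on andre_to_updown_cycle {w. min_first w \<and> andre_cycle w}"
  proof (rule inj_onI, clarify)
    fix w w'
    assume "min_first w" "andre_cycle w" "min_first w'" "andre_cycle w'"
      "andre_to_updown_cycle w = andre_to_updown_cycle w'"
    then have "hd w = hd w'" "tl w = tl w'" "w \<noteq> []" "w' \<noteq> []"
      by (auto simp: andre_cycle_def andre_to_updown_cycle_def min_first_def andre_to_alt_inject)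
    then show "w = w'" by (simp add: list.expand)
  qed
  show "andre_to_updown_cycle ` {w. min_first w \<and> andre_cycle w} = {w. min_first w \<and> updown_cycle w}"
  proof safe
    fix w assume w: "min_first w" "andre_cycle w"
    then obtain a v where "w = a # v" by (cases w) (auto simp: min_first_def)
    with w andre_to_alt_properties[of v]
    show "min_first (andre_to_updown_cycle w)" "updown_cycle (andre_to_updown_cycle w)"
      by (auto simp: andre_cycle_def andre_to_updown_cycle_def min_first_Cons updown_cycle_Cons)
  next
    fix d assume d: "min_first d" "updown_cycle d"
    then obtain a v where av: "d = a # v" by (cases d) (auto simp: min_first_def)
    with d have v: "distinct v" "alternates False v" "\<forall>x\<in>set v. a < x"
      by (auto simp: min_first_Cons updown_cycle_Cons)
    then obtain w where w: "andre w" "andre_to_alt w = v"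
      using andre_to_alt_surj[of v] by auto
    with v andre_to_alt_properties[OF w(1)] andre_distinct[OF w(1)]
    have "min_first (a # w)" "andre_cycle (a # w)" "d = andre_to_updown_cycle (a # w)"
      by (auto simp: min_first_Cons andre_cycle_def andre_to_updown_cycle_def av)
    then show "d \<in> andre_to_updown_cycle ` {w. min_first w \<and> andre_cycle w}" by blast
  qed
qed

text \<open>
  The leading minimum \<open>a\<close> is the first extreme letter and has nothing in front of it. Removing it
  therefore does not change \<open>mix\<close>.
\<close>

lemma hat_drop_andre_to_updown_cycle:
  assumes "min_first w" "andre_cycle w"
  shows "hat_drop_cycle (andre_to_updown_cycle w) = des (tl w) + of_bool (length w > 1)"
proof -
  obtain a v where w: "w = a # v" using assms(1) by (cases w) (auto simp: min_first_def)
  have v: "set (andre_to_alt v) = set v" "mix (andre_to_alt v) = des v"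
    using assms andre_to_alt_properties[of v] by (auto simp: w andre_cycle_def)
  have "Min (set (a # andre_to_alt v)) = a"
    using assms v by (intro Min_eqI) (auto simp: w min_first_Cons intro: less_imp_le)
  then have "first_extreme [] a (andre_to_alt v)" by (simp add: first_extreme_def)
  from mix_first_extreme[OF this] v have "mix (a # andre_to_alt v) = des v" by simp
  moreover have "andre_to_alt v = [] \<longleftrightarrow> v = []" using v(1) by (metis set_empty)
  ultimately show ?thesis
    by (simp add: hat_drop_cycle_def andre_to_updown_cycle_def w)
qed


section \<open>Rewriting the cycles of a permutation\<close>

lemma cycle_of_list_nth:
  assumes "distinct w" "i < length w"
  shows "cycle_of_list w (w ! i) = w ! (Suc i mod length w)"
proof -
  have "map (cycle_of_list w) w ! i = rotate 1 w ! i"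
    using cyclic_rotation[OF assms(1), of 1] by simp
  with assms(2) show ?thesis by (simp add: nth_rotate del: rotate_Suc)
qed

text \<open>
  A function that acts on the letters of \<open>w\<close> as the cycle \<open>w\<close> returns this very word when its orbit is
  listed from the first letter. It may act in any way outside \<open>w\<close>, so the lemma applies to each cycle
  of a permutation.
\<close>

lemma support_orbit_cycle_of_list:
  assumes w: "distinct w" "w \<noteq> []" and eq: "\<And>x. x \<in> set w \<Longrightarrow> f x = cycle_of_list w x"
  shows "support f (hd w) = w" "x \<in> set w \<Longrightarrow> orbit f x = set w"
proof -
  let ?k = "length w"
  have step: "f (w ! i) = w ! (Suc i mod ?k)" if "i < ?k" for i
    using that eq[of "w ! i"] cycle_of_list_nth[OF w(1)] by simp
  have pow: "(f ^^ i) (w ! j) = w ! ((i + j) mod ?k)" if "j < ?k" for i j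
  proof (induction i)
    case (Suc i)
    have "(i + j) mod ?k < ?k" using w by simp
    from step[OF this] Suc show ?case by (simp add: mod_Suc_eq)
  qed (use that in simp)
  have hd: "hd w = w ! 0" "0 < ?k" using w by (simp_all add: hd_conv_nth)
  have ret: "(f ^^ i) (hd w) = hd w \<longleftrightarrow> i mod ?k = 0" for i
    using pow[of 0 i] w hd by (simp add: nth_eq_iff_index_eq)
  have "least_power f (hd w) = ?k"
    unfolding least_power_def ret
  proof (rule Least_equality)
    fix i assume "i mod ?k = 0 \<and> 0 < i"
    then show "?k \<le> i" by (auto dest: mod_less)
  qed (use hd in simp)
  moreover have "(f ^^ i) (hd w) = w ! i" if "i < ?k" for i
    using pow[of 0 i] that hd by simp
  ultimately show "support f (hd w) = w" by (intro nth_equalityI) auto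
  assume "x \<in> set w"
  then obtain j where j: "j < ?k" "x = w ! j" by (metis in_set_conv_nth)
  have "(f ^^ ?k) x = x" using pow[OF j(1)] j by simp
  then have "orbit f x = {(f ^^ i) x | i. i < ?k}" using hd(2) by (rule orbit_altdef_bounded)
  also have "\<dots> = set w"
  proof (intro set_eqI iffI)
    fix y assume "y \<in> set w"
    then obtain i where i: "i < ?k" "y = w ! i" by (metis in_set_conv_nth)
    \<comment> \<open>The number of steps from position \<open>j\<close> to position \<open>i\<close>, passing the end of the word if needed.\<close>
    let ?d = "(i + (?k - j)) mod ?k"
    have "(?d + j) mod ?k = (i + ?k) mod ?k"
      using j(1) by (simp add: mod_add_left_eq)
    then have "(f ^^ ?d) x = y" using pow[OF j(1), of ?d] i j by simp
    moreover have "?d < ?k" using hd by simp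
    ultimately show "y \<in> {(f ^^ i) x | i. i < ?k}" by blast
  qed (use pow[OF j(1)] j hd in auto)
  finally show "orbit f x = set w" .
qed

context
  fixes n :: nat and \<sigma> :: "nat \<Rightarrow> nat"
  assumes \<sigma>: "\<sigma> permutes {1..n}"
begin

lemma permutation_\<sigma>: "permutation \<sigma>"
  using \<sigma> by (auto simp: permutation_permutes)

lemma Union_perm_cycles: "\<Union>(perm_cycles n \<sigma>) = {1..n}"
  using permutes_orbit_subset[OF \<sigma>] permutation_self_in_orbit[OF permutation_\<sigma>]
  by (fastforce simp: perm_cycles_def)

lemma orbit_perm_cycle: "C \<in> perm_cycles n \<sigma> \<Longrightarrow> x \<in> C \<Longrightarrow> orbit \<sigma> x = C"
  using orbit_cyclic_eq3[OF cyclic_on_orbit'[OF permutation_\<sigma>]] by (auto simp: perm_cycles_def)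

lemma cycle_word_perm_cycle:
  assumes C: "C \<in> perm_cycles n \<sigma>"
  shows "set (cycle_word \<sigma> C) = C" "min_first (cycle_word \<sigma> C)"
    "x \<in> C \<Longrightarrow> cycle_of_list (cycle_word \<sigma> C) x = \<sigma> x"
proof -
  have "C \<subseteq> {1..n}" using C Union_perm_cycles by blast
  then have "finite C" by (rule finite_subset) simp
  moreover have ne: "C \<noteq> {}" using C by (auto simp: perm_cycles_def orbit_nonempty)
  ultimately have Min: "orbit \<sigma> (Min C) = C" by (intro orbit_perm_cycle C Min_in)
  then show set: "set (cycle_word \<sigma> C) = C"
    using orbit_altdef_permutation[OF permutation_\<sigma>, of "Min C"]
    unfolding cycle_word_def support_set[OF permutation_\<sigma>]
    by (simp only: Min full_SetCompr_eq simp_thms)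
  have "least_power \<sigma> (Min C) > 0" using permutation_\<sigma> by (rule least_power_of_permutation)
  then have "hd (cycle_word \<sigma> C) = Min C" unfolding cycle_word_def by (simp add: hd_map)
  moreover have "distinct (cycle_word \<sigma> C)"
    unfolding cycle_word_def by (rule cycle_of_permutation[OF permutation_\<sigma>])
  ultimately show "min_first (cycle_word \<sigma> C)"
    using set ne by (auto simp: min_first_def)
  assume "x \<in> C"
  then show "cycle_of_list (cycle_word \<sigma> C) x = \<sigma> x"
    unfolding cycle_word_def
    by (intro cycle_restrict[symmetric] permutation_\<sigma>) (use set in \<open>simp add: cycle_word_def\<close>)
qed

end

text \<open>
  The permutation whose cycle words are obtained by applying \<open>G\<close> to the cycle words of \<open>\<sigma>\<close>. Each
  element consults only the cycle on which it lies.
\<close>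

definition rewrite_cycles :: "nat \<Rightarrow> (nat list \<Rightarrow> nat list) \<Rightarrow> (nat \<Rightarrow> nat) \<Rightarrow> nat \<Rightarrow> nat" where
  "rewrite_cycles n G \<sigma> x =
     (if x \<in> {1..n} then cycle_of_list (G (cycle_word \<sigma> (orbit \<sigma> x))) x else x)"

text \<open>
  If \<open>G\<close> permutes the letters of each cycle word of \<open>\<sigma>\<close> and leaves the minimum in front, then the new
  words are again the cycle words of a permutation, with the same orbits.
\<close>

lemma rewrite_cycles:
  assumes \<sigma>: "\<sigma> permutes {1..n}"
    and G: "\<And>C. C \<in> perm_cycles n \<sigma> \<Longrightarrow>
      min_first (G (cycle_word \<sigma> C)) \<and> set (G (cycle_word \<sigma> C)) = C"
  shows "rewrite_cycles n G \<sigma> permutes {1..n}"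
    and "x \<in> {1..n} \<Longrightarrow> orbit (rewrite_cycles n G \<sigma>) x = orbit \<sigma> x"
    and "perm_cycles n (rewrite_cycles n G \<sigma>) = perm_cycles n \<sigma>"
    and "C \<in> perm_cycles n \<sigma> \<Longrightarrow> cycle_word (rewrite_cycles n G \<sigma>) C = G (cycle_word \<sigma> C)"
proof -
  let ?\<tau> = "rewrite_cycles n G \<sigma>"
  have \<tau>: "?\<tau> x = cycle_of_list (G (cycle_word \<sigma> C)) x" if "C \<in> perm_cycles n \<sigma>" "x \<in> C" for x C
    using that Union_perm_cycles[OF \<sigma>] orbit_perm_cycle[OF \<sigma> that]
    unfolding rewrite_cycles_def by auto
  have word: "support ?\<tau> (Min C) = G (cycle_word \<sigma> C)"
    and orb: "x \<in> C \<Longrightarrow> orbit ?\<tau> x = C" if C: "C \<in> perm_cycles n \<sigma>" for x C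
    using support_orbit_cycle_of_list[of "G (cycle_word \<sigma> C)" ?\<tau>] G[OF C] \<tau>[OF C]
    by (auto simp: min_first_def)
  show orbits: "orbit ?\<tau> x = orbit \<sigma> x" if "x \<in> {1..n}" for x
    using orb[of "orbit \<sigma> x" x] that permutation_self_in_orbit[OF permutation_\<sigma>[OF \<sigma>]]
    by (simp add: perm_cycles_def)
  then show "perm_cycles n ?\<tau> = perm_cycles n \<sigma>"
    unfolding perm_cycles_def by (intro image_cong) auto
  show "C \<in> perm_cycles n \<sigma> \<Longrightarrow> cycle_word ?\<tau> C = G (cycle_word \<sigma> C)"
    using word unfolding cycle_word_def .
  have "?\<tau> ` C = C" if C: "C \<in> perm_cycles n \<sigma>" for C
    using \<tau>[OF C] G[OF C] cycle_is_surj[of "G (cycle_word \<sigma> C)"]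
    by (simp add: min_first_def cong: image_cong_simp)
  then have "?\<tau> ` \<Union>(perm_cycles n \<sigma>) = \<Union>(perm_cycles n \<sigma>)" by (auto simp: image_Union)
  then have surj: "?\<tau> ` {1..n} = {1..n}" unfolding Union_perm_cycles[OF \<sigma>] .
  then have "bij_betw ?\<tau> {1..n} {1..n}"
    by (simp add: bij_betw_def eq_card_imp_inj_on)
  then show "?\<tau> permutes {1..n}"
    by (rule bij_imp_permutes) (auto simp: rewrite_cycles_def)
qed

lemma rewrite_cycles_inverse:
  assumes \<sigma>: "\<sigma> permutes {1..n}"
    and G: "\<And>C. C \<in> perm_cycles n \<sigma> \<Longrightarrow>
      min_first (G (cycle_word \<sigma> C)) \<and> set (G (cycle_word \<sigma> C)) = C"
    and H: "\<And>C. C \<in> perm_cycles n \<sigma> \<Longrightarrow> H (G (cycle_word \<sigma> C)) = cycle_word \<sigma> C"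
  shows "rewrite_cycles n H (rewrite_cycles n G \<sigma>) = \<sigma>"
proof
  fix x
  let ?\<tau> = "rewrite_cycles n G \<sigma>"
  show "rewrite_cycles n H ?\<tau> x = \<sigma> x"
  proof (cases "x \<in> {1..n}")
    case True
    let ?C = "orbit \<sigma> x"
    have C: "?C \<in> perm_cycles n \<sigma>" using True by (simp add: perm_cycles_def)
    have "rewrite_cycles n H ?\<tau> x = cycle_of_list (H (cycle_word ?\<tau> ?C)) x"
      using True rewrite_cycles(2)[OF \<sigma> G True] by (simp add: rewrite_cycles_def[of n H])
    also have "\<dots> = \<sigma> x"
      using rewrite_cycles(4)[OF \<sigma> G C] H[OF C] cycle_word_perm_cycle(3)[OF \<sigma> C]
        permutation_self_in_orbit[OF permutation_\<sigma>[OF \<sigma>]] by simp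
    finally show ?thesis .
  next
    case False
    then show ?thesis using \<sigma> by (auto simp: rewrite_cycles_def permutes_def)
  qed
qed

text \<open>
  A letter-preserving bijection between two kinds of cycles extends to the permutations all of whose
  cycles are of these kinds: rewriting with the inverse bijection undoes the rewriting.
\<close>

lemma bij_betw_rewrite_cycles:
  assumes bij: "bij_betw G {w. min_first w \<and> P w} {w. min_first w \<and> Q w}"
    and set: "\<And>w. min_first w \<Longrightarrow> P w \<Longrightarrow> set (G w) = set w"
  shows "bij_betw (rewrite_cycles n G)
    {\<sigma>. \<sigma> permutes {1..n} \<and> (\<forall>C\<in>perm_cycles n \<sigma>. P (cycle_word \<sigma> C))}
    {\<sigma>. \<sigma> permutes {1..n} \<and> (\<forall>C\<in>perm_cycles n \<sigma>. Q (cycle_word \<sigma> C))}"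
proof -
  define H where "H = inv_into {w. min_first w \<and> P w} G"
  have G: "min_first (G w) \<and> Q (G w) \<and> H (G w) = w" if "min_first w" "P w" for w
    using that bij bij_betw_apply[OF bij] unfolding H_def by (auto simp: bij_betw_inv_into_left)
  have H: "min_first (H w) \<and> P (H w) \<and> G (H w) = w" if "min_first w" "Q w" for w
    using that bij bij_betw_apply[OF bij_betw_inv_into[OF bij]] unfolding H_def
    by (auto simp: bij_betw_inv_into_right)
  have setH: "set (H w) = set w" if "min_first w" "Q w" for w
    using H[OF that] set[of "H w"] by simp
  show ?thesis
  proof (rule bij_betw_byWitness[where f' = "rewrite_cycles n H"]; safe)
    fix \<sigma> assume \<sigma>: "\<sigma> permutes {1..n}" "\<forall>C\<in>perm_cycles n \<sigma>. P (cycle_word \<sigma> C)"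
    note W = cycle_word_perm_cycle(1,2)[OF \<sigma>(1)]
    have G': "min_first (G (cycle_word \<sigma> C)) \<and> set (G (cycle_word \<sigma> C)) = C"
      if "C \<in> perm_cycles n \<sigma>" for C using that \<sigma>(2) G set W by auto
    show "rewrite_cycles n H (rewrite_cycles n G \<sigma>) = \<sigma>"
      using \<sigma>(2) G W(2) by (intro rewrite_cycles_inverse \<sigma>(1) G') auto
    show "rewrite_cycles n G \<sigma> permutes {1..n}" by (rule rewrite_cycles(1)[OF \<sigma>(1) G'])
    fix C assume "C \<in> perm_cycles n (rewrite_cycles n G \<sigma>)"
    then have C: "C \<in> perm_cycles n \<sigma>" by (simp only: rewrite_cycles(3)[OF \<sigma>(1) G'])
    then show "Q (cycle_word (rewrite_cycles n G \<sigma>) C)"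
      using G W(2) \<sigma>(2) by (simp add: rewrite_cycles(4)[OF \<sigma>(1) G'])
  next
    fix \<sigma> assume \<sigma>: "\<sigma> permutes {1..n}" "\<forall>C\<in>perm_cycles n \<sigma>. Q (cycle_word \<sigma> C)"
    note W = cycle_word_perm_cycle(1,2)[OF \<sigma>(1)]
    have H': "min_first (H (cycle_word \<sigma> C)) \<and> set (H (cycle_word \<sigma> C)) = C"
      if "C \<in> perm_cycles n \<sigma>" for C using that \<sigma>(2) H setH W by auto
    show "rewrite_cycles n G (rewrite_cycles n H \<sigma>) = \<sigma>"
      using \<sigma>(2) H W(2) by (intro rewrite_cycles_inverse \<sigma>(1) H') auto
    show "rewrite_cycles n H \<sigma> permutes {1..n}" by (rule rewrite_cycles(1)[OF \<sigma>(1) H'])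
    fix C assume "C \<in> perm_cycles n (rewrite_cycles n H \<sigma>)"
    then have C: "C \<in> perm_cycles n \<sigma>" by (simp only: rewrite_cycles(3)[OF \<sigma>(1) H'])
    then show "P (cycle_word (rewrite_cycles n H \<sigma>) C)"
      using H W(2) \<sigma>(2) by (simp add: rewrite_cycles(4)[OF \<sigma>(1) H'])
  qed
qed


section \<open>Drops as descents of cycle words\<close>

lemma des_eq_sum: "des w = (\<Sum>i<length w - 1. of_bool (w ! Suc i < w ! i))"
  by (induction w rule: des.induct) (simp_all add: sum.lessThan_Suc_shift del: sum.lessThan_Suc)

text \<open>
  Going once around the cycle, the steps inside the word that start behind the minimum give the descents
  of the tail; the step from the minimum is an ascent, and the return to the minimum is a drop unless
  the cycle is a fixed point.
\<close>

lemma drops_of_cycle: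
  assumes w: "min_first w"
  shows "(\<Sum>x\<in>set w. of_bool (cycle_of_list w x < x)) = des (tl w) + of_bool (length w > 1)"
proof -
  obtain a v where av: "w = a # v" using w by (cases w) (auto simp: min_first_def)
  let ?k = "length v"
  have dist: "distinct w" using w by (simp add: min_first_def)
  have "(\<Sum>x\<in>set w. of_bool (cycle_of_list w x < x)) =
      (\<Sum>i<length w. of_bool (cycle_of_list w (w ! i) < w ! i))"
    using bij_betw_nth[OF dist refl refl] by (rule sum.reindex_bij_betw[symmetric])
  also have "\<dots> = (\<Sum>i<Suc ?k. of_bool (w ! (Suc i mod Suc ?k) < w ! i))"
    using cycle_of_list_nth[OF dist] by (intro sum.cong) (auto simp: av)
  also have "\<dots> = (\<Sum>i<?k. of_bool (w ! Suc i < w ! i)) + of_bool (a < w ! ?k)"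
    by (simp add: av)
  also have "(\<Sum>i<?k. of_bool (w ! Suc i < w ! i)) = des w"
    by (simp add: des_eq_sum av)
  also have "des w = des v"
    using des_append_min[of "[]" v a] w by (simp add: av min_first_Cons)
  also have "of_bool (a < w ! ?k) = of_bool (length w > 1)"
    using w by (cases v rule: rev_cases) (auto simp: av min_first_Cons nth_append)
  finally show ?thesis by (simp add: av)
qed

lemma perm_drop_eq_sum:
  assumes \<sigma>: "\<sigma> permutes {1..n}"
  shows "perm_drop n \<sigma> = (\<Sum>C\<in>perm_cycles n \<sigma>.
    des (tl (cycle_word \<sigma> C)) + of_bool (length (cycle_word \<sigma> C) > 1))"
proof -
  let ?drop = "\<lambda>x. of_bool (\<sigma> x < x) :: nat"
  have "perm_drop n \<sigma> = (\<Sum>x\<in>{1..n}. ?drop x)"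
    by (simp add: perm_drop_def Int_def)
  also have "\<dots> = sum ?drop (\<Union>(perm_cycles n \<sigma>))"
    unfolding Union_perm_cycles[OF \<sigma>] ..
  also have "\<dots> = (\<Sum>C\<in>perm_cycles n \<sigma>. sum ?drop C)"
  proof (subst sum.Union_disjoint)
    show "\<forall>C\<in>perm_cycles n \<sigma>. finite C"
      using cycle_word_perm_cycle(1)[OF \<sigma>] by (metis List.finite_set)
    show "\<forall>C\<in>perm_cycles n \<sigma>. \<forall>D\<in>perm_cycles n \<sigma>. C \<noteq> D \<longrightarrow> C \<inter> D = {}"
      using orbit_perm_cycle[OF \<sigma>] by blast
  qed simp
  also have "\<dots> = (\<Sum>C\<in>perm_cycles n \<sigma>.
      des (tl (cycle_word \<sigma> C)) + of_bool (length (cycle_word \<sigma> C) > 1))"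
  proof (rule sum.cong)
    fix C assume C: "C \<in> perm_cycles n \<sigma>"
    note W = cycle_word_perm_cycle[OF \<sigma> C]
    show "sum ?drop C = des (tl (cycle_word \<sigma> C)) + of_bool (length (cycle_word \<sigma> C) > 1)"
      using drops_of_cycle[OF W(2)] W(1,3) by simp
  qed simp
  finally show ?thesis .
qed


section \<open>The equidistribution theorem\<close>

theorem theorem1p6:
  fixes n :: nat and \<alpha> t :: "'a :: comm_semiring_1"
  assumes "n \<ge> 1"
  shows "(\<exists>\<Lambda>. bij_betw \<Lambda> (web_perms n) (cycle_updown_perms n) \<and>
            (\<forall>\<sigma> \<in> web_perms n. perm_drop n \<sigma> = hat_drop n (\<Lambda> \<sigma>))) \<and>
         (\<forall>i \<le> n div 2.
            gamma_coeff (n + 1) i \<alpha> t =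
              (\<Sum>\<sigma> | \<sigma> \<in> cycle_updown_perms n \<and> hat_drop n \<sigma> = i.
                 t ^ perm_fix n \<sigma> * \<alpha> ^ perm_cyc n \<sigma>))"
proof -
  define \<Lambda> where "\<Lambda> = rewrite_cycles n andre_to_updown_cycle"
  have bij: "bij_betw \<Lambda> (web_perms n) (cycle_updown_perms n)"
    unfolding \<Lambda>_def web_perms_def cycle_updown_perms_def
    by (rule bij_betw_rewrite_cycles[OF bij_betw_andre_to_updown_cycle set_andre_to_updown_cycle])
  have stats: "hat_drop n (\<Lambda> \<sigma>) = perm_drop n \<sigma>" "perm_fix n (\<Lambda> \<sigma>) = perm_fix n \<sigma>"
    "perm_cyc n (\<Lambda> \<sigma>) = perm_cyc n \<sigma>" if "\<sigma> \<in> web_perms n" for \<sigma>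
  proof -
    from that have \<sigma>: "\<sigma> permutes {1..n}"
      and web: "\<And>C. C \<in> perm_cycles n \<sigma> \<Longrightarrow> andre_cycle (cycle_word \<sigma> C)"
      by (auto simp: web_perms_def)
    note W = cycle_word_perm_cycle(1,2)[OF \<sigma>]
    have G: "min_first (andre_to_updown_cycle (cycle_word \<sigma> C)) \<and>
        set (andre_to_updown_cycle (cycle_word \<sigma> C)) = C" if "C \<in> perm_cycles n \<sigma>" for C
      using bij_betw_apply[OF bij_betw_andre_to_updown_cycle, of "cycle_word \<sigma> C"]
        set_andre_to_updown_cycle W web that by auto
    note rw = rewrite_cycles[OF \<sigma> G, folded \<Lambda>_def]
    show "perm_cyc n (\<Lambda> \<sigma>) = perm_cyc n \<sigma>"
      using rw(3) by (simp add: perm_cyc_def)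
    show "perm_fix n (\<Lambda> \<sigma>) = perm_fix n \<sigma>"
      unfolding perm_fix_def using rw(2)
      by (intro arg_cong[of _ _ card] Collect_cong conj_cong refl) (metis orbit_eq_singleton_iff)
    show "hat_drop n (\<Lambda> \<sigma>) = perm_drop n \<sigma>"
      unfolding hat_drop_def perm_drop_eq_sum[OF \<sigma>] using rw(3,4) W(2) web
      by (intro sum.cong) (simp_all add: hat_drop_andre_to_updown_cycle)
  qed
  have "gamma_coeff (n + 1) i \<alpha> t =
      (\<Sum>\<sigma> | \<sigma> \<in> cycle_updown_perms n \<and> hat_drop n \<sigma> = i.
         t ^ perm_fix n \<sigma> * \<alpha> ^ perm_cyc n \<sigma>)" for i
  proof -
    have "bij_betw \<Lambda> {\<sigma> \<in> web_perms n. perm_drop n \<sigma> = i}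
        {\<sigma> \<in> cycle_updown_perms n. hat_drop n \<sigma> = i}"
      using bij by (rule bij_betw_Collect) (simp add: stats)
    then show ?thesis
      unfolding gamma_coeff_def by (simp add: stats flip: sum.reindex_bij_betw)
  qed
  with bij stats(1) show ?thesis by metis
qed

end
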